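(* Let $p$ be a prime, let $1\le a_1\le a_2\le a_3\le a_4$ be integers, let $\lambda=(a_4,a_3,a_2,a_1)$, and let $N_b(\lambda)$ denote the number of subgroups of order $p^b$ in $\mathbb{Z}/p^{a_1}\times\mathbb{Z}/p^{a_2}\times\mathbb{Z}/p^{a_3}\times\mathbb{Z}/p^{a_4}$. Put $D=(p-1)(p^2-1)(p^3-1)$. Then the following hold. (1) If $0\le b\le a_1$, then $$N_b(\lambda)=\frac{p^{3b+6}-p^{2b+5}-p^{2b+4}-p^{2b+3}+p^{b+3}+p^{b+2}+p^{b+1}-1}{D}.$$ (2) If $a_1\le b\le a_2$, then $N_b(\lambda)=A/D$, where $$A=p^{2b+a_1+6}+p^{2b+a_1+5}+p^{2b+a_1+4}-p^{2a_1+b+5}-p^{2a_1+b+4}-p^{2a_1+b+3}+p^{3a_1+3}$$ $$\qquad-p^{2b+5}-p^{2b+4}-p^{2b+3}+p^{b+3}+p^{b+2}+p^{b+1}-1.$$ (3) If $a_2\le b\le\min\{a_3,a_1+a_2\}$, then $N_b(\lambda)=B/D$, where $$B=(b+1-a_2)p^{a_2+a_1+b+6}+(b+1-a_2)p^{a_2+a_1+b+5}+(a_2-b-1)p^{a_2+a_1+b+3}+(a_2-b-1)p^{a_1+a_2+b+2}$$ $$\qquad+p^{2a_2+a_1+4}+p^{a_1+2a_2+3}+p^{a_1+2a_2+2}-p^{2a_1+b+5}-p^{2a_1+b+4}-p^{2a_1+b+3}$$ $$\qquad+p^{b+3}+p^{b+2}+p^{b+1}+p^{3a_1+3}-p^{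2b+5}-p^{2b+4}-p^{2b+3}-1.$$
   Context: $\mathbb{Z}/p^{a}$ denotes the cyclic group of order $p^a$. In a finite abelian group of order $p^n$ the number of subgroups of order $p^b$ equals the number of subgroups of index $p^b$, so $N_b(\lambda)$ may be read either way. *)

theory Defs
  imports Complex_Main "HOL-Algebra.Algebra" "HOL-Computational_Algebra.Primes"
begin

(* A partition lists its parts in decreasing order; the factors come in increasing order. *)
definition abelian_p_group :: "nat \<Rightarrow> nat \<times> nat \<times> nat \<times> nat \<Rightarrow> (int \<times> int \<times> int \<times> int) monoid" where
  "abelian_p_group p = (\<lambda>(l1, l2, l3, l4).
     integer_mod_group (p ^ l4) \<times>\<times> integer_mod_group (p ^ l3) \<times>\<times>
     integer_mod_group (p ^ l2) \<times>\<times> integer_mod_group (p ^ l1))"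

definition num_subgroups :: "nat \<Rightarrow> nat \<Rightarrow> nat \<times> nat \<times> nat \<times> nat \<Rightarrow> nat" where
  "num_subgroups p b lam = card {H. subgroup H (abelian_p_group p lam) \<and> card H = p ^ b}"

end

theory Submission
  imports Defs
begin

text \<open>Split off a cyclic factor: a subgroup of order \<open>p\<^bsup>b\<^esup>\<close> of \<open>A \<times> \<int>/p\<^bsup>a\<^esup>\<close> amounts to a choice of \<open>m\<close>,
  a subgroup \<open>K\<close> of \<open>A\<close> of order \<open>p\<^bsup>b-m\<^esup>\<close> and a homomorphism \<open>K \<rightarrow> \<int>/p\<^bsup>a-m\<^esup>\<close>. When \<open>b \<le> a\<close>, the
  number of these homomorphisms is \<open>|K|\<close>, so \<open>N\<^sub>b(A \<times> \<int>/p\<^bsup>a\<^esup>)\<close> is the sum of \<open>p\<^bsup>j\<^esup> N\<^sub>j(A)\<close> over \<open>j \<le> b\<close>.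
  Applying this to the two largest factors leaves the group of rank two, whose \<open>N\<^sub>i\<close> is the sum of \<open>p\<^bsup>k\<^esup>\<close>
  over \<open>k \<le> min(i, a\<^sub>1, a\<^sub>1 + a\<^sub>2 - i)\<close>; the three cases of the theorem are the three regimes of
  this minimum.\<close>

section \<open>Homomorphisms to cyclic groups and subgroups of a product with a cyclic group\<close>

text \<open>Extensionality makes every homomorphism on the carrier correspond to exactly one
  function, so that \<open>card\<close> counts homomorphisms.\<close>

definition homs :: "('a, 'c) monoid_scheme \<Rightarrow> nat \<Rightarrow> ('a \<Rightarrow> int) set" where
  "homs G n = hom G (integer_mod_group n) \<inter> extensional (carrier G)"

lemma homs_range: "\<lbrakk>\<phi> \<in> homs G n; 0 < n; x \<in> carrier G\<rbrakk> \<Longrightarrow> 0 \<le> \<phi> x \<and> \<phi> x < int n"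
  by (auto simp: homs_def hom_def Pi_iff carrier_integer_mod_group)

lemma homs_mult: "\<lbrakk>\<phi> \<in> homs G n; x \<in> carrier G; y \<in> carrier G\<rbrakk> \<Longrightarrow> \<phi> (x \<otimes>\<^bsub>G\<^esub> y) = (\<phi> x + \<phi> y) mod int n"
  by (auto simp: homs_def hom_def)

lemma homsI:
  assumes "0 < n" "\<phi> \<in> extensional (carrier G)"
    and "\<And>x. x \<in> carrier G \<Longrightarrow> 0 \<le> \<phi> x \<and> \<phi> x < int n"
    and "\<And>x y. \<lbrakk>x \<in> carrier G; y \<in> carrier G\<rbrakk> \<Longrightarrow> \<phi> (x \<otimes>\<^bsub>G\<^esub> y) = (\<phi> x + \<phi> y) mod int n"
  shows "\<phi> \<in> homs G n"
  using assms by (auto simp: homs_def hom_def Pi_iff carrier_integer_mod_group)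

lemma homs_one: "\<lbrakk>\<phi> \<in> homs G n; group G\<rbrakk> \<Longrightarrow> \<phi> \<one>\<^bsub>G\<^esub> = 0"
  using hom_one[of \<phi> G "integer_mod_group n"] by (simp add: homs_def)

lemma homs_nat_pow:
  "\<lbrakk>\<phi> \<in> homs G n; group G; x \<in> carrier G\<rbrakk> \<Longrightarrow> \<phi> (x [^]\<^bsub>G\<^esub> (m::nat)) = (int m * \<phi> x) mod int n"
  using hom_nat_pow[of \<phi> G "integer_mod_group n" x m] by (simp add: homs_def)

lemma homs_inv:
  assumes "\<phi> \<in> homs G n" "0 < n" "group G" "x \<in> carrier G"
  shows "\<phi> (inv\<^bsub>G\<^esub> x) = (- \<phi> x) mod int n"
proof -
  interpret group_hom G "integer_mod_group n" \<phi>
    using assms by (simp add: homs_def group_hom_def group_hom_axioms_def)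
  show ?thesis using assms by simp
qed

lemma finite_homs: "\<lbrakk>finite (carrier G); 0 < n\<rbrakk> \<Longrightarrow> finite (homs G n)"
  by (rule finite_subset[OF _ finite_PiE[of "carrier G" "\<lambda>_. {0..<int n}"]])
    (auto simp: homs_def hom_def PiE_def carrier_integer_mod_group)

section \<open>Residue classes and the subgroups of a cyclic group\<close>

text \<open>Serves three counts: the multiples of \<open>d\<close> in \<int>/n, the fibres of a
  lifted graph, and the solutions \<open>y\<close> of a congruence \<open>p y = w\<close> modulo
  \<open>n\<close>.\<close>

lemma card_residue_class:
  fixes d n r :: int
  assumes "0 \<le> r" "r < d" "0 \<le> n"
  shows "card {c \<in> {0..<d * n}. c mod d = r} = nat n"
proof -
  have "{c \<in> {0..<d * n}. c mod d = r} = (\<lambda>t. d * t + r) ` {0..<n}"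
  proof (intro equalityI subsetI)
    fix c assume c: "c \<in> {c \<in> {0..<d * n}. c mod d = r}"
    have "c = d * (c div d) + r" using c by (metis (mono_tags, lifting) mem_Collect_eq mult_div_mod_eq)
    moreover from this have "d * (c div d) < d * n" using c assms(1) by (metis (mono_tags, lifting) add_increasing2 atLeastLessThan_iff leD leI mem_Collect_eq)
    then have "c div d < n" using assms by simp
    moreover have "0 \<le> c div d" using c assms by (auto intro: pos_imp_zdiv_nonneg_iff[THEN iffD2])
    ultimately show "c \<in> (\<lambda>t. d * t + r) ` {0..<n}" by auto
  next
    fix c assume "c \<in> (\<lambda>t. d * t + r) ` {0..<n}"
    then obtain t where t: "0 \<le> t" "t < n" "c = d * t + r" by auto
    have "d * t + r < d * (t + 1)" using assms by (simp add: algebra_simps)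
    also have "\<dots> \<le> d * n" using t assms by (intro mult_left_mono) auto
    finally show "c \<in> {c \<in> {0..<d * n}. c mod d = r}" using t assms by simp
  qed
  moreover have "inj_on (\<lambda>t. d * t + r) {0..<n}" using assms by (auto simp: inj_on_def)
  ultimately show ?thesis by (simp add: card_image)
qed

text \<open>The order of \<open>M\<close> annihilates \<open>M\<close>, so every element is a
  multiple of \<open>d = n div card M\<close>. There are only \<open>card M\<close> such multiples
  below \<open>n\<close>, hence the inclusion is an equality.\<close>

lemma subgroup_integer_mod_group:
  assumes "0 < n" "subgroup M (integer_mod_group n)"
  shows "card M dvd n" "M = {c \<in> {0..<int n}. int (n div card M) dvd c}"
proof -
  let ?Z = "integer_mod_group n"
  have sub: "M \<subseteq> {0..<int n}" using subgroup.subset[OF assms(2)] assms(1)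
    by (simp add: carrier_integer_mod_group)
  then have fin: "finite M" by (rule finite_subset) simp
  show dvd: "card M dvd n"
    using group.lagrange[OF group_integer_mod_group assms(2)] assms(1)
    by (metis card_atLeastLessThan_int carrier_integer_mod_group diff_zero dvd_triv_right nat_int not_less_zero order_def)
  have pos: "0 < card M" using dvd assms(1) by (metis dvd_0_left_iff neq0_conv)
  define d where "d = n div card M"
  have n: "n = card M * d" using dvd by (simp add: d_def)
  have "int d dvd c" if "c \<in> M" for c
  proof -
    interpret M: group "?Z\<lparr>carrier := M\<rparr>"
      using group.subgroup_imp_group[OF group_integer_mod_group assms(2)] .
    have "c [^]\<^bsub>?Z\<lparr>carrier := M\<rparr>\<^esub> card M = 0"
      using M.pow_order_eq_1[of c] that by (simp add: order_def)
    then have "(int (card M) * c) mod int n = 0"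
      using monoid.nat_pow_consistent[of ?Z c "card M" M] by (simp add: group.is_monoid)
    then have "int (card M) * int d dvd int (card M) * c"
      using n by (metis mod_0_imp_dvd of_nat_mult)
    then show ?thesis using pos by simp
  qed
  then have subset: "M \<subseteq> {c \<in> {0..<int n}. int d dvd c}" using sub by auto
  have "card {c \<in> {0..<int n}. int d dvd c} = card M"
    using card_residue_class[of 0 "int d" "int (card M)"] n assms(1)
    by (simp add: mod_eq_0_iff_dvd mult.commute)
  with subset show "M = {c \<in> {0..<int n}. int (n div card M) dvd c}"
    unfolding d_def[symmetric] 
    by (intro card_subset_eq finite_subset[of "{c \<in> {0..<int n}. int d dvd c}" "{0..<int n}"]) auto
qed

section \<open>Subgroups of A \<times> \<int>/n as lifted graphs\<close>

text \<open>This is the preimage of the graph of \<phi> : K \<rightarrow> \<int>/d under reduction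
  of the second coordinate modulo \<open>d\<close>, for \<open>d\<close> dividing
  \<open>n\<close>.\<close>

definition lift_graph :: "nat \<Rightarrow> nat \<Rightarrow> 'a set \<Rightarrow> ('a \<Rightarrow> int) \<Rightarrow> ('a \<times> int) set" where
  "lift_graph n d K \<phi> = {(x, c). x \<in> K \<and> c \<in> {0..<int n} \<and> c mod int d = \<phi> x}"

lemma lift_graph_Sigma: "lift_graph n d K \<phi> = Sigma K (\<lambda>x. {c \<in> {0..<int n}. c mod int d = \<phi> x})"
  by (auto simp: lift_graph_def)

lemma card_lift_graph:
  assumes "finite K" "0 < n" "d dvd n" "\<And>x. x \<in> K \<Longrightarrow> 0 \<le> \<phi> x \<and> \<phi> x < int d"
  shows "card (lift_graph n d K \<phi>) = card K * (n div d)"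
proof -
  have n: "int n = int d * int (n div d)" using assms(3) by (metis dvd_mult_div_cancel of_nat_mult)
  have "card {c \<in> {0..<int n}. c mod int d = \<phi> x} = n div d" if "x \<in> K" for x
    using card_residue_class[of "\<phi> x" "int d" "int (n div d)"] assms(4)[OF that] n by simp
  moreover have "finite {c \<in> {0..<int n}. c mod int d = \<phi> x}" for x
    by (rule finite_subset[of _ "{0..<int n}"]) auto
  ultimately show ?thesis using assms(1) unfolding lift_graph_Sigma by (subst card_SigmaI) simp_all
qed

lemma fst_lift_graph:
  assumes "0 < n" "d dvd n" "\<And>x. x \<in> K \<Longrightarrow> 0 \<le> \<phi> x \<and> \<phi> x < int d"
  shows "fst ` lift_graph n d K \<phi> = K"
proof (intro equalityI subsetI)
  fix x assume "x \<in> K"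
  moreover have "int d \<le> int n" using assms by (simp add: dvd_imp_le)
  ultimately have "(x, \<phi> x) \<in> lift_graph n d K \<phi>"
    using assms(3)[of x] by (auto simp: lift_graph_def)
  then show "x \<in> fst ` lift_graph n d K \<phi>" by force
qed (auto simp: lift_graph_def)

text \<open>Since \<phi> x lies below \<open>d\<close>, and hence below \<open>n\<close>, the pair
  (x, \<phi> x) is itself a point of the graph. Its membership in the graph of \<psi> reads \<psi> x
  = \<phi> x mod d = \<phi> x.\<close>

lemma lift_graph_inj:
  assumes "0 < n" "d dvd n" "lift_graph n d K \<phi> = lift_graph n d K \<psi>"
    and "\<And>x. x \<in> K \<Longrightarrow> 0 \<le> \<phi> x \<and> \<phi> x < int d" "\<phi> \<in> extensional K" "\<psi> \<in> extensional K"
  shows "\<phi> = \<psi>"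
proof (rule extensionalityI[OF assms(5,6)])
  fix x assume "x \<in> K"
  moreover have "int d \<le> int n" using assms by (simp add: dvd_imp_le)
  ultimately have "(x, \<phi> x) \<in> lift_graph n d K \<phi>"
    using assms(4)[of x] by (auto simp: lift_graph_def)
  then have "(x, \<phi> x) \<in> lift_graph n d K \<psi>" using assms(3) by simp
  then show "\<phi> x = \<psi> x" using assms(4)[OF \<open>x \<in> K\<close>] by (simp add: lift_graph_def)
qed

lemma subgroup_lift_graph:
  assumes "group A" "subgroup K A" "0 < n" "d dvd n" "\<phi> \<in> homs (A\<lparr>carrier := K\<rparr>) d"
  shows "subgroup (lift_graph n d K \<phi>) (A \<times>\<times> integer_mod_group n)"
proof -
  interpret A: group A by fact
  interpret K: subgroup K A by fact
  interpret P: group "A \<times>\<times> integer_mod_group n" using assms by (simp add: DirProd_group)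
  have d: "0 < d" "int d dvd int n" using assms by (auto intro: Nat.gr0I)
  have gK: "group (A\<lparr>carrier := K\<rparr>)" using A.subgroup_imp_group[OF assms(2)] .
  have r: "0 \<le> \<phi> x \<and> \<phi> x < int d" if "x \<in> K" for x using homs_range[OF assms(5) d(1)] that by simp
  show ?thesis
  proof (rule P.subgroupI)
    show "lift_graph n d K \<phi> \<subseteq> carrier (A \<times>\<times> integer_mod_group n)"
      using K.subset assms(3) by (auto simp: lift_graph_def carrier_integer_mod_group)
    show "lift_graph n d K \<phi> \<noteq> {}"
      using fst_lift_graph[OF assms(3,4), of K \<phi>] r K.one_closed by blast
  next
    fix a assume a: "a \<in> lift_graph n d K \<phi>"
    obtain x c where [simp]: "a = (x, c)" by force
    have *: "x \<in> K" "0 \<le> c" "c < int n" "c mod int d = \<phi> x" using a by (auto simp: lift_graph_def)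
    \<comment> \<open>Because \<open>d\<close> divides \<open>n\<close>, reducing modulo
      \<open>n\<close> first does not affect the residue modulo \<open>d\<close>; closure under
      products rests on the same fact.\<close>
    have "((- c) mod int n) mod int d = \<phi> (inv\<^bsub>A\<^esub> x)"
      using homs_inv[OF assms(5) d(1) gK, of x] * assms(2) d(2)
        mod_minus_eq[of c "int d"] mod_mod_cancel[OF d(2), of "- c"] by simp
    moreover have "inv\<^bsub>A \<times>\<times> integer_mod_group n\<^esub> (x, c) = (inv\<^bsub>A\<^esub> x, (- c) mod int n)"
      using * assms(3) K.subset by (subst inv_DirProd) (auto simp: carrier_integer_mod_group)
    ultimately show "inv\<^bsub>A \<times>\<times> integer_mod_group n\<^esub> a \<in> lift_graph n d K \<phi>"
      using * assms(3) by (simp add: lift_graph_def)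
  next
    fix a b assume ab: "a \<in> lift_graph n d K \<phi>" "b \<in> lift_graph n d K \<phi>"
    obtain x c y e where [simp]: "a = (x, c)" "b = (y, e)" by force
    have *: "x \<in> K" "y \<in> K" "c mod int d = \<phi> x" "e mod int d = \<phi> y"
      using ab by (auto simp: lift_graph_def)
    have "((c + e) mod int n) mod int d = (c mod int d + e mod int d) mod int d"
      using d(2) by (simp add: mod_mod_cancel mod_add_eq)
    also have "\<dots> = \<phi> (x \<otimes>\<^bsub>A\<^esub> y)" using homs_mult[OF assms(5), of x y] * by simp
    finally show "a \<otimes>\<^bsub>A \<times>\<times> integer_mod_group n\<^esub> b \<in> lift_graph n d K \<phi>"
      using * assms(3) by (simp add: lift_graph_def)
  qed
qed

text \<open>The fibre \<open>M\<close> of \<open>H\<close> over the identity consists of the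
  multiples of some \<open>d\<close>. Every other nonempty fibre is a coset of \<open>M\<close>,
  that is, a full residue class modulo \<open>d\<close>, and this class depends homomorphically on
  the first coordinate.\<close>

lemma subgroup_DirProd_cyclic_is_lift_graph:
  assumes "group A" "0 < n" "subgroup H (A \<times>\<times> integer_mod_group n)"
  obtains d K \<phi> where "d dvd n" "subgroup K A" "\<phi> \<in> homs (A\<lparr>carrier := K\<rparr>) d"
    "H = lift_graph n d K \<phi>"
proof -
  let ?Z = "integer_mod_group n"
  interpret A: group A by fact
  interpret Z: group ?Z by simp
  interpret P: group "A \<times>\<times> ?Z" using assms by (simp add: DirProd_group)
  interpret H: subgroup H "A \<times>\<times> ?Z" by fact
  define K where "K = fst ` H"
  define M where "M = {c. (\<one>\<^bsub>A\<^esub>, c) \<in> H}"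
  have carr: "x \<in> carrier A" "0 \<le> c" "c < int n" if "(x, c) \<in> H" for x c
    using H.subset that assms(2) by (auto simp: carrier_integer_mod_group)
  have mult: "(x \<otimes>\<^bsub>A\<^esub> y, (c + e) mod int n) \<in> H" if "(x, c) \<in> H" "(y, e) \<in> H" for x y c e
    using H.m_closed[OF that] by simp
  have inv: "(inv\<^bsub>A\<^esub> x, (- c) mod int n) \<in> H" if "(x, c) \<in> H" for x c
  proof -
    have "x \<in> carrier A" "c \<in> carrier ?Z" using H.subset that by auto
    then have "inv\<^bsub>A \<times>\<times> ?Z\<^esub> (x, c) = (inv\<^bsub>A\<^esub> x, (- c) mod int n)"
      by (simp add: assms(1))
    then show ?thesis using H.m_inv_closed[OF that] by simp
  qed
  have K: "subgroup K A"
  proof (rule A.subgroupI)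
    show "K \<subseteq> carrier A" using carr by (auto simp: K_def)
    show "K \<noteq> {}" using H.one_closed by (auto simp: K_def)
  qed (auto simp: K_def image_iff Bex_def dest: inv mult)
  have M: "subgroup M ?Z"
  proof (rule Z.subgroupI)
    show "M \<subseteq> carrier ?Z" using carr assms(2) by (auto simp: M_def carrier_integer_mod_group)
    show "M \<noteq> {}" using H.one_closed by (auto simp: M_def)
  next
    fix c assume "c \<in> M"
    then show "inv\<^bsub>?Z\<^esub> c \<in> M"
      using inv[of "\<one>\<^bsub>A\<^esub>" c] carr[of "\<one>\<^bsub>A\<^esub>" c] assms(2) by (simp add: M_def carrier_integer_mod_group)
  next
    fix c e assume "c \<in> M" "e \<in> M"
    then show "c \<otimes>\<^bsub>?Z\<^esub> e \<in> M"
      using mult[of "\<one>\<^bsub>A\<^esub>" c "\<one>\<^bsub>A\<^esub>" e] by (simp add: M_def)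
  qed
  define d where "d = n div card M"
  have dn: "d dvd n" using subgroup_integer_mod_group(1)[OF assms(2) M]
    by (metis d_def dvd_mult_div_cancel dvd_triv_right)
  then have d0: "0 < d" using assms(2) by (auto intro: Nat.gr0I)
  have dn': "int d dvd int n" using dn by simp
  have Mem: "c \<in> M \<longleftrightarrow> 0 \<le> c \<and> c < int n \<and> int d dvd c" for c
    using subgroup_integer_mod_group(2)[OF assms(2) M] unfolding d_def by auto
  \<comment> \<open>A fibre lies in one residue class: the quotient of two of its points has first
    coordinate the identity, so it gives an element of \<open>M\<close>.\<close>
  have same: "c mod int d = e mod int d" if "(x, c) \<in> H" "(x, e) \<in> H" for x c e
  proof -
    have "(c + (- e) mod int n) mod int n \<in> M"
      using mult[OF that(1) inv[OF that(2)]] carr(1)[OF that(1)] by (simp add: M_def)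
    then have "int d dvd (c - e) mod int n" using Mem by (simp add: mod_simps)
    then have "int d dvd c - e" using dn' by (meson dvd_mod_iff)
    then show ?thesis by (simp add: mod_eq_dvd_iff)
  qed
  \<comment> \<open>Conversely a nonempty fibre fills its residue class, since it can be translated
    by any element of \<open>M\<close>.\<close>
  have diff: "(x, e) \<in> H" if "(x, c) \<in> H" "0 \<le> e" "e < int n" "e mod int d = c mod int d" for x c e
  proof -
    have "int d dvd (e - c) mod int n" using that(4) dn' by (metis dvd_mod mod_eq_dvd_iff)
    then have "(\<one>\<^bsub>A\<^esub>, (e - c) mod int n) \<in> H" using Mem[of "(e - c) mod int n"] assms(2) by (simp add: M_def)
    from mult[OF that(1) this] show ?thesis using that carr(1)[OF that(1)] by (simp add: mod_simps)
  qed
  \<comment> \<open>The choice of \<open>c\<close> is immaterial by \<open>same\<close>; the next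
    fact \<open>\<phi>\<close> records this.\<close>
  define \<phi> where "\<phi> = (\<lambda>x\<in>K. (SOME c. (x, c) \<in> H) mod int d)"
  have \<phi>: "\<phi> x = c mod int d" if "(x, c) \<in> H" for x c
  proof -
    have "x \<in> K" using that by (force simp: K_def)
    moreover have "(x, SOME c. (x, c) \<in> H) \<in> H" using that by (rule someI)
    ultimately show ?thesis using same[OF _ that] by (simp add: \<phi>_def)
  qed
  have ex: "\<exists>c. (x, c) \<in> H" if "x \<in> K" for x using that by (auto simp: K_def)
  have "\<phi> \<in> homs (A\<lparr>carrier := K\<rparr>) d"
  proof (rule homsI)
    show "\<phi> \<in> extensional (carrier (A\<lparr>carrier := K\<rparr>))" by (simp add: \<phi>_def)
  next
    fix x assume "x \<in> carrier (A\<lparr>carrier := K\<rparr>)"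
    then show "0 \<le> \<phi> x \<and> \<phi> x < int d" using d0 by (simp add: \<phi>_def)
  next
    fix x y assume "x \<in> carrier (A\<lparr>carrier := K\<rparr>)" "y \<in> carrier (A\<lparr>carrier := K\<rparr>)"
    then obtain c e where ce: "(x, c) \<in> H" "(y, e) \<in> H" using ex by force
    have "\<phi> (x \<otimes>\<^bsub>A\<^esub> y) = (c + e) mod int d"
      using \<phi>[OF mult[OF ce]] dn' by (simp add: mod_mod_cancel)
    then show "\<phi> (x \<otimes>\<^bsub>A\<lparr>carrier := K\<rparr>\<^esub> y) = (\<phi> x + \<phi> y) mod int d"
      using \<phi> ce by (simp add: mod_simps)
  qed (use d0 in simp)
  moreover have "H = lift_graph n d K \<phi>"
  proof (intro equalityI subsetI)
    fix z assume "z \<in> H"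
    then show "z \<in> lift_graph n d K \<phi>"
      using carr \<phi> by (cases z) (force simp: lift_graph_def K_def)
  next
    fix z assume z: "z \<in> lift_graph n d K \<phi>"
    obtain x e where [simp]: "z = (x, e)" by force
    obtain c where "(x, c) \<in> H" using z ex by (auto simp: lift_graph_def)
    then show "z \<in> H" using diff[of x c e] z \<phi>[of x c] by (auto simp: lift_graph_def)
  qed
  ultimately show thesis using that dn K by blast
qed

section \<open>Counting subgroups of a product with a cyclic group\<close>

definition subgroups_of_card :: "('a, 'c) monoid_scheme \<Rightarrow> nat \<Rightarrow> 'a set set" where
  "subgroups_of_card G n = {H. subgroup H G \<and> card H = n}"

lemma finite_subgroups_of_card: "finite (carrier G) \<Longrightarrow> finite (subgroups_of_card G n)"
  by (rule finite_subset[of _ "Pow (carrier G)"]) (auto simp: subgroups_of_card_def dest: subgroup.subset)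

lemma card_subgroups_iso:
  assumes "group G" "group H" "h \<in> iso G H"
  shows "card (subgroups_of_card G n) = card (subgroups_of_card H n)"
proof -
  have hom: "h \<in> hom G H" and inj: "inj_on h (carrier G)" and im: "h ` carrier G = carrier H"
    using assms(3) by (simp_all add: iso_def bij_betw_def)
  let ?g = "inv_into (carrier G) h"
  have g: "?g \<in> iso H G" using assms by (simp add: group.iso_set_sym)
  have gh: "group_hom G H h" "group_hom H G ?g"
    using assms hom g by (simp_all add: group_hom_def group_hom_axioms_def iso_imp_homomorphism)
  have "bij_betw ((`) h) (subgroups_of_card G n) (subgroups_of_card H n)"
  proof (rule bij_betw_imageI)
    show "inj_on ((`) h) (subgroups_of_card G n)"
      using inj_on_image_eq_iff[OF inj] by (simp add: inj_on_def subgroups_of_card_def subgroup.subset)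
    show "(`) h ` subgroups_of_card G n = subgroups_of_card H n"
    proof (intro equalityI subsetI)
      fix L assume "L \<in> (`) h ` subgroups_of_card G n"
      then show "L \<in> subgroups_of_card H n"
        using group_hom.subgroup_img_is_subgroup[OF gh(1)]
        by (auto simp: subgroups_of_card_def intro!: card_image inj_on_subset[OF inj] dest: subgroup.subset)
    next
      fix L assume "L \<in> subgroups_of_card H n"
      then have L: "subgroup L H" "card L = n" by (auto simp: subgroups_of_card_def)
      then have sub: "L \<subseteq> carrier H" by (simp add: subgroup.subset)
      have "inj_on ?g L" using sub im by (simp add: inj_on_inv_into)
      then have "?g ` L \<in> subgroups_of_card G n"
        using L group_hom.subgroup_img_is_subgroup[OF gh(2)] by (simp add: subgroups_of_card_def card_image)
      moreover have "h ` ?g ` L = L" using sub im by (simp add: image_inv_into_cancel)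
      ultimately show "L \<in> (`) h ` subgroups_of_card G n" by (metis image_eqI)
    qed
  qed
  then show ?thesis by (rule bij_betw_same_card)
qed

text \<open>As in Goursat's lemma, a subgroup \<open>H\<close> of \<open>A \<times> \<int>/n\<close> is given by its projection
  \<open>K\<close> to \<open>A\<close> and a homomorphism from \<open>K\<close> to the quotient of \<open>\<int>/n\<close> by the fibre of \<open>H\<close>.\<close>

lemma card_subgroups_DirProd_cyclic:
  assumes "group A" "finite (carrier A)" "Factorial_Ring.prime p"
  shows "card (subgroups_of_card (A \<times>\<times> integer_mod_group (p ^ a)) (p ^ b)) =
    (\<Sum>m\<le>min a b. \<Sum>K\<in>subgroups_of_card A (p ^ (b - m)). card (homs (A\<lparr>carrier := K\<rparr>) (p ^ (a - m))))"
proof -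
  \<comment> \<open>Here p^m is the order of the fibre over the identity. A subgroup of order p^b
    then has a projection \<open>K\<close> of order p^(b-m), and the quotient of \<int>/p^a by the
    fibre has order p^(a-m).\<close>
  define S where "S = (SIGMA m:{..min a b}. SIGMA K:subgroups_of_card A (p ^ (b - m)). homs (A\<lparr>carrier := K\<rparr>) (p ^ (a - m)))"
  define F :: "nat \<times> 'a set \<times> ('a \<Rightarrow> int) \<Rightarrow> ('a \<times> int) set"
    where "F = (\<lambda>(m, K, \<phi>). lift_graph (p ^ a) (p ^ (a - m)) K \<phi>)"
  have p: "1 < p" using assms(3) by (rule prime_gt_1_nat)
  then have p0: "0 < p ^ k" for k by simp
  have finK: "finite K" if "subgroup K A" for K using finite_subset[OF subgroup.subset[OF that] assms(2)] .
  have dvd: "p ^ (a - m) dvd p ^ a" for m by (simp add: le_imp_power_dvd)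
  have div: "p ^ a div p ^ (a - m) = p ^ m" if "m \<le> a" for m
    using that p by (metis div_mult_self_is_m le_add_diff_inverse p0 power_add)
  have r: "0 \<le> \<phi> x \<and> \<phi> x < int (p ^ e)" if "\<phi> \<in> homs (A\<lparr>carrier := K\<rparr>) (p ^ e)" "x \<in> K" for \<phi> K e x
    using homs_range[OF that(1) p0] that(2) by simp
  have "bij_betw F S (subgroups_of_card (A \<times>\<times> integer_mod_group (p ^ a)) (p ^ b))"
  proof (rule bij_betw_imageI)
    show "inj_on F S"
    proof (rule inj_onI)
      fix s t assume "s \<in> S" "t \<in> S" and eq: "F s = F t"
      then obtain m K \<phi> n L \<psi> where st: "s = (m, K, \<phi>)" "t = (n, L, \<psi>)"
        and m: "m \<le> a" "m \<le> b" "subgroup K A" "card K = p ^ (b - m)" "\<phi> \<in> homs (A\<lparr>carrier := K\<rparr>) (p ^ (a - m))"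
        and n: "n \<le> a" "n \<le> b" "subgroup L A" "card L = p ^ (b - n)" "\<psi> \<in> homs (A\<lparr>carrier := L\<rparr>) (p ^ (a - n))"
        by (auto simp: S_def subgroups_of_card_def)
      have "fst ` lift_graph (p ^ a) (p ^ (a - m)) K \<phi> = K"
        by (rule fst_lift_graph[OF p0 dvd r[OF m(5)]])
      moreover have "fst ` lift_graph (p ^ a) (p ^ (a - n)) L \<psi> = L"
        by (rule fst_lift_graph[OF p0 dvd r[OF n(5)]])
      ultimately have KL: "K = L" using eq by (simp add: F_def st)
      then have "p ^ (b - m) = p ^ (b - n)" using m n by simp
      then have "b - m = b - n" using p by (meson power_inject_exp)
      \<comment> \<open>Both numbers are at most \<open>b\<close>, so the truncated differences
        determine them.\<close>
      then have mn: "m = n" using m n by linarith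
      have "\<phi> = \<psi>"
      proof (rule lift_graph_inj[OF p0 dvd _ r[OF m(5)]])
        show "lift_graph (p ^ a) (p ^ (a - m)) K \<phi> = lift_graph (p ^ a) (p ^ (a - m)) K \<psi>"
          using eq by (simp add: F_def st KL mn)
      qed (use m(5) n(5) in \<open>auto simp: homs_def KL\<close>)
      then show "s = t" using KL mn st by simp
    qed
    show "F ` S = subgroups_of_card (A \<times>\<times> integer_mod_group (p ^ a)) (p ^ b)"
    proof (intro equalityI subsetI)
      fix H assume "H \<in> F ` S"
      then obtain m K \<phi> where H: "H = lift_graph (p ^ a) (p ^ (a - m)) K \<phi>"
        and m: "m \<le> a" "m \<le> b" "subgroup K A" "card K = p ^ (b - m)" "\<phi> \<in> homs (A\<lparr>carrier := K\<rparr>) (p ^ (a - m))"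
        by (auto simp: S_def F_def subgroups_of_card_def)
      have "subgroup H (A \<times>\<times> integer_mod_group (p ^ a))"
        unfolding H by (rule subgroup_lift_graph[OF assms(1) m(3) p0 dvd m(5)])
      moreover have "card H = p ^ b"
      proof -
        have "card H = card K * (p ^ a div p ^ (a - m))"
          unfolding H by (rule card_lift_graph[OF finK[OF m(3)] p0 dvd r[OF m(5)]])
        then show ?thesis using m by (simp add: div power_add[symmetric])
      qed
      ultimately show "H \<in> subgroups_of_card (A \<times>\<times> integer_mod_group (p ^ a)) (p ^ b)"
        by (simp add: subgroups_of_card_def)
    next
      fix H assume "H \<in> subgroups_of_card (A \<times>\<times> integer_mod_group (p ^ a)) (p ^ b)"
      then have H: "subgroup H (A \<times>\<times> integer_mod_group (p ^ a))" "card H = p ^ b"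
        by (auto simp: subgroups_of_card_def)
      obtain d K \<phi> where d: "d dvd p ^ a" and K: "subgroup K A" and \<phi>: "\<phi> \<in> homs (A\<lparr>carrier := K\<rparr>) d"
        and eq: "H = lift_graph (p ^ a) d K \<phi>"
        using subgroup_DirProd_cyclic_is_lift_graph[OF assms(1) p0 H(1)] by metis
      obtain e where e: "e \<le> a" "d = p ^ e" using d assms(3) divides_primepow_nat by blast
      define m where "m = a - e"
      have m: "m \<le> a" "d = p ^ (a - m)" using e by (auto simp: m_def)
      have "p ^ b = card K * p ^ m"
        using card_lift_graph[OF finK[OF K] p0 d, of \<phi>] r[of \<phi> K e] \<phi> H(2) eq m by (simp add: div e(2))
      moreover from this have "m \<le> b" using p by (metis dvd_triv_right power_dvd_imp_le)
      ultimately have "card K = p ^ (b - m)"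
        using p0[of m] by (metis le_add_diff_inverse2 mult_right_cancel power_add less_irrefl)
      then have "(m, K, \<phi>) \<in> S" using m \<open>m \<le> b\<close> K \<phi> by (simp add: S_def subgroups_of_card_def)
      moreover have "H = F (m, K, \<phi>)" using eq m by (simp add: F_def)
      ultimately show "H \<in> F ` S" by blast
    qed
  qed
  then have "card (subgroups_of_card (A \<times>\<times> integer_mod_group (p ^ a)) (p ^ b)) = card S"
    by (metis bij_betw_same_card)
  moreover have "finite (homs (A\<lparr>carrier := K\<rparr>) (p ^ e))" if "K \<in> subgroups_of_card A k" for K e k
    using that finK p0 by (intro finite_homs) (auto simp: subgroups_of_card_def)
  ultimately show ?thesis
    using finite_subgroups_of_card[OF assms(2)]
    by (simp add: S_def card_SigmaI finite_SigmaI)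
qed

section \<open>Counting homomorphisms from an abelian p-group\<close>

lemma homs_subgroup_mult:
  "\<lbrakk>\<phi> \<in> homs (G\<lparr>carrier := K\<rparr>) n; x \<in> K; y \<in> K\<rbrakk> \<Longrightarrow> \<phi> (x \<otimes>\<^bsub>G\<^esub> y) = (\<phi> x + \<phi> y) mod int n"
  using homs_mult[of \<phi> "G\<lparr>carrier := K\<rparr>" n x y] by simp

lemma homs_subgroup_nat_pow:
  "\<lbrakk>\<phi> \<in> homs (G\<lparr>carrier := K\<rparr>) n; group G; subgroup K G; x \<in> K\<rbrakk>
    \<Longrightarrow> \<phi> (x [^]\<^bsub>G\<^esub> (m::nat)) = (int m * \<phi> x) mod int n"
  using homs_nat_pow[of \<phi> "G\<lparr>carrier := K\<rparr>" n x m] group.subgroup_imp_group[of G K]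
    monoid.nat_pow_consistent[of G x m K] by (simp add: group.is_monoid)

text \<open>Fix \<open>x \<notin> K\<close>. An extension to \<open>G\<close> of \<open>\<phi> : K \<rightarrow> \<int>/n\<close> is given by its value \<open>y\<close> at \<open>x\<close>, subject only
  to \<open>p y = \<phi>(x\<^bsup>p\<^esup>)\<close>. The divisibility assumption on \<open>n\<close> makes \<open>\<phi>(x\<^bsup>p\<^esup>)\<close> a multiple of \<open>p\<close>, so
  there are \<open>p\<close> solutions.\<close>

lemma card_homs_index_prime:
  assumes "comm_group G" "finite (carrier G)" "subgroup K G" "Factorial_Ring.prime p"
    and index: "order G = p * card K" and n: "p * card K dvd n" "0 < n"
  shows "card (homs G n) = p * card (homs (G\<lparr>carrier := K\<rparr>) n)"
proof -
  interpret G: comm_group G by fact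
  interpret K: subgroup K G by fact
  let ?K = "G\<lparr>carrier := K\<rparr>"
  interpret gK: group ?K using G.subgroup_imp_group[OF assms(3)] .
  interpret KN: normal K G using assms(3) by (rule G.subgroup_imp_normal)
  have p: "1 < p" using assms(4) by (rule prime_gt_1_nat)
  have finK: "finite K" using finite_subset[OF K.subset assms(2)] .
  then have cK: "0 < card K" using K.one_closed card_gt_0_iff by blast
  have "K \<noteq> carrier G" using index p cK by (auto simp: order_def)
  then obtain x where x: "x \<in> carrier G" "x \<notin> K" using K.subset by blast
  have powK: "y [^]\<^bsub>G\<^esub> (i::nat) \<in> K" if "y \<in> K" for y i using that by (induction i) auto
  \<comment> \<open>The quotient by \<open>K\<close> has order \<open>p\<close>, so the coset of
    \<open>x\<close> has trivial p-th power.\<close>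
  have xp: "x [^]\<^bsub>G\<^esub> p \<in> K"
  proof -
    interpret Q: group "G Mod K" by (rule KN.factorgroup_is_group)
    have "order (G Mod K) * card K = order G"
      using G.lagrange[OF assms(3)] by (simp add: order_def FactGroup_def)
    then have "order (G Mod K) = p" using index cK by simp
    moreover have "K #>\<^bsub>G\<^esub> x \<in> carrier (G Mod K)" using x by (auto simp: FactGroup_def RCOSETS_def)
    ultimately have "(K #>\<^bsub>G\<^esub> x) [^]\<^bsub>G Mod K\<^esub> p = K"
      using Q.pow_order_eq_1[of "K #>\<^bsub>G\<^esub> x"] by simp
    moreover have "(K #>\<^bsub>G\<^esub> x) [^]\<^bsub>G Mod K\<^esub> (i::nat) = K #>\<^bsub>G\<^esub> (x [^]\<^bsub>G\<^esub> i)" for i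
      using x by (induction i) (simp_all add: KN.rcos_sum G.coset_mult_one K.subset)
    ultimately show ?thesis using G.coset_join1[of K "x [^]\<^bsub>G\<^esub> p"] x assms(3) by simp
  qed
  \<comment> \<open>For \<open>i\<close> prime to \<open>p\<close>, a Bezout relation i u = p v + 1
    would write \<open>x\<close> as a quotient of elements of \<open>K\<close>.\<close>
  have xdvd: "p dvd i" if "x [^]\<^bsub>G\<^esub> i \<in> K" for i
  proof (rule ccontr)
    assume "\<not> p dvd i"
    then have "coprime i p" using prime_imp_coprime[OF assms(4)] by (simp add: coprime_commute)
    moreover have "i \<noteq> 0" using \<open>\<not> p dvd i\<close> dvd_0_right by metis
    ultimately obtain u v where uv: "i * u = p * v + 1" using bezout_nat[of i p] by auto
    have "(x [^]\<^bsub>G\<^esub> i) [^]\<^bsub>G\<^esub> u = (x [^]\<^bsub>G\<^esub> p) [^]\<^bsub>G\<^esub> v \<otimes>\<^bsub>G\<^esub> x"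
      using x by (simp add: G.nat_pow_pow uv)
    then have "(x [^]\<^bsub>G\<^esub> p) [^]\<^bsub>G\<^esub> v \<otimes>\<^bsub>G\<^esub> x \<in> K" using powK[OF that] by metis
    then have "x \<in> K"
      using powK[OF xp] x by (metis G.l_cancel_one G.inv_solve_left K.m_closed K.m_inv_closed K.mem_carrier)
    then show False using x by simp
  qed
  \<comment> \<open>Normal form: each element of \<open>G\<close> is k x^i with \<open>k\<close> in
    \<open>K\<close> and a unique i < p. Uniqueness follows from \<open>xdvd\<close>, existence from
    comparing cardinalities.\<close>
  define f where "f = (\<lambda>(k, i::nat). k \<otimes>\<^bsub>G\<^esub> x [^]\<^bsub>G\<^esub> i)"
  have inj: "inj_on f (K \<times> {..<p})"
  proof -
    have *: "k = l \<and> i = j" if "k \<in> K" "l \<in> K" "i < p" "i \<le> j" "j < p"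
      and e: "k \<otimes>\<^bsub>G\<^esub> x [^]\<^bsub>G\<^esub> i = l \<otimes>\<^bsub>G\<^esub> x [^]\<^bsub>G\<^esub> j" for k l i j
    proof -
      have kl: "k \<in> carrier G" "l \<in> carrier G" using that K.subset by auto
      have "x [^]\<^bsub>G\<^esub> j = x [^]\<^bsub>G\<^esub> (j - i) \<otimes>\<^bsub>G\<^esub> x [^]\<^bsub>G\<^esub> i"
        using that x by (simp add: G.nat_pow_mult)
      then have "k \<otimes>\<^bsub>G\<^esub> x [^]\<^bsub>G\<^esub> i = (l \<otimes>\<^bsub>G\<^esub> x [^]\<^bsub>G\<^esub> (j - i)) \<otimes>\<^bsub>G\<^esub> x [^]\<^bsub>G\<^esub> i"
        using e kl x by (simp add: G.m_assoc)
      then have k: "k = l \<otimes>\<^bsub>G\<^esub> x [^]\<^bsub>G\<^esub> (j - i)" using kl x by simp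
      then have "x [^]\<^bsub>G\<^esub> (j - i) = inv\<^bsub>G\<^esub> l \<otimes>\<^bsub>G\<^esub> k" using kl x by (simp add: G.inv_solve_left)
      then have "p dvd j - i" using xdvd that by simp
      then have "i = j" using that by (metis diff_is_0_eq dvd_imp_le le_antisym less_imp_diff_less linorder_not_less nat_neq_iff not_less_zero neq0_conv)
      then show ?thesis using k kl x by simp
    qed
    show ?thesis
    proof (rule inj_onI)
      fix s t assume st: "s \<in> K \<times> {..<p}" "t \<in> K \<times> {..<p}" "f s = f t"
      obtain k i l j where eq: "s = (k, i)" "t = (l, j)" by (metis surj_pair)
      have kl: "k \<in> K" "l \<in> K" "i < p" "j < p" "k \<otimes>\<^bsub>G\<^esub> x [^]\<^bsub>G\<^esub> i = l \<otimes>\<^bsub>G\<^esub> x [^]\<^bsub>G\<^esub> j"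
        using st by (simp_all add: eq f_def)
      consider "i \<le> j" | "j \<le> i" by linarith
      then show "s = t"
      proof cases
        case 1
        then show ?thesis using *[OF kl(1,2,3) 1 kl(4,5)] by (simp add: eq)
      next
        case 2
        then show ?thesis using *[OF kl(2,1,4) 2 kl(3) kl(5)[symmetric]] by (simp add: eq)
      qed
    qed
  qed
  have im: "f ` (K \<times> {..<p}) = carrier G"
  proof (rule card_subset_eq[OF assms(2)])
    show "f ` (K \<times> {..<p}) \<subseteq> carrier G" using x K.subset by (auto simp: f_def)
    show "card (f ` (K \<times> {..<p})) = card (carrier G)"
      using index by (simp add: card_image[OF inj] card_cartesian_product order_def)
  qed
  have dec: "\<exists>k\<in>K. \<exists>i::nat. g = k \<otimes>\<^bsub>G\<^esub> x [^]\<^bsub>G\<^esub> i" if "g \<in> carrier G" for g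
  proof -
    have "g \<in> f ` (K \<times> {..<p})" using that im by simp
    then show ?thesis by (auto simp: f_def)
  qed
  define R where "R = (\<lambda>\<psi>. (restrict \<psi> K, \<psi> x) :: ('a \<Rightarrow> int) \<times> int)"
  \<comment> \<open>These are the admissible values at \<open>x\<close> of an extension of
    \<phi>.\<close>
  define Y where "Y = (\<lambda>\<phi> :: 'a \<Rightarrow> int. {y \<in> {0..<int n}. (int p * y) mod int n = \<phi> (x [^]\<^bsub>G\<^esub> p)})"
  have "bij_betw R (homs G n) (Sigma (homs ?K n) Y)"
  proof (rule bij_betw_imageI)
    show "inj_on R (homs G n)"
    proof (rule inj_onI)
      fix \<phi> \<psi> assume h: "\<phi> \<in> homs G n" "\<psi> \<in> homs G n" and "R \<phi> = R \<psi>"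
      then have "\<phi> x = \<psi> x" "restrict \<phi> K = restrict \<psi> K" by (simp_all add: R_def)
      then have eq: "\<phi> x = \<psi> x" "\<And>k. k \<in> K \<Longrightarrow> \<phi> k = \<psi> k" by (metis restrict_apply')+
      show "\<phi> = \<psi>"
      proof (rule extensionalityI[of _ "carrier G"])
        fix g assume "g \<in> carrier G"
        then obtain k i where "k \<in> K" "g = k \<otimes>\<^bsub>G\<^esub> x [^]\<^bsub>G\<^esub> (i::nat)" using dec by blast
        then show "\<phi> g = \<psi> g"
          using h x K.subset eq by (auto simp: homs_mult homs_nat_pow)
      qed (use h in \<open>auto simp: homs_def\<close>)
    qed
    show "R ` homs G n = Sigma (homs ?K n) Y"
    proof (intro equalityI subsetI)
      fix z assume "z \<in> R ` homs G n"
      then obtain \<psi> where \<psi>: "\<psi> \<in> homs G n" "z = R \<psi>" by auto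
      have "restrict \<psi> K \<in> homs ?K n"
        using \<psi>(1) n(2) K.subset by (intro homsI) (auto simp: homs_range homs_mult subset_iff)
      moreover have "\<psi> x \<in> Y (restrict \<psi> K)"
        using homs_range[OF \<psi>(1) n(2) x(1)] xp homs_nat_pow[OF \<psi>(1) _ x(1)] by (simp add: Y_def)
      ultimately show "z \<in> Sigma (homs ?K n) Y" by (simp add: \<psi>(2) R_def)
    next
      fix z assume "z \<in> Sigma (homs ?K n) Y"
      then obtain \<phi> y where \<phi>: "\<phi> \<in> homs ?K n" and "y \<in> Y \<phi>" and z: "z = (\<phi>, y)" by (rule SigmaE)
      then have y: "0 \<le> y" "y < int n" "(int p * y) mod int n = \<phi> (x [^]\<^bsub>G\<^esub> p)" by (auto simp: Y_def)
      have \<phi>m: "\<phi> (k \<otimes>\<^bsub>G\<^esub> l) = (\<phi> k + \<phi> l) mod int n" if "k \<in> K" "l \<in> K" for k l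
        using that by (rule homs_subgroup_mult[OF \<phi>])
      have \<phi>p: "\<phi> (k [^]\<^bsub>G\<^esub> i) = (int i * \<phi> k) mod int n" if "k \<in> K" for k and i :: nat
        using that by (rule homs_subgroup_nat_pow[OF \<phi> G.is_group assms(3)])
      define u where "u = (\<lambda>g. inv_into (K \<times> {..<p}) f g)"
      \<comment> \<open>The extension is defined through the normal form, with \<open>u\<close> the
        inverse of \<open>f\<close>.\<close>
      define \<psi> where "\<psi> = (\<lambda>g\<in>carrier G. (\<phi> (fst (u g)) + int (snd (u g)) * y) mod int n)"
      have \<psi>1: "\<psi> (k \<otimes>\<^bsub>G\<^esub> x [^]\<^bsub>G\<^esub> i) = (\<phi> k + int i * y) mod int n" if "k \<in> K" "i < p" for k i
      proof -
        have "u (f (k, i)) = (k, i)" using that inj by (simp add: u_def)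
        then have "u (k \<otimes>\<^bsub>G\<^esub> x [^]\<^bsub>G\<^esub> i) = (k, i)" by (simp add: f_def)
        moreover have "k \<otimes>\<^bsub>G\<^esub> x [^]\<^bsub>G\<^esub> i \<in> carrier G" using that x by simp
        ultimately show ?thesis by (simp add: \<psi>_def)
      qed
      \<comment> \<open>The formula is extended from i < p to all exponents: whole multiples of
        \<open>p\<close> are moved into \<open>K\<close>, and the condition p y = \<phi>(x^p) makes
        the two computations agree. Multiplicativity then needs no carry.\<close>
      have \<psi>: "\<psi> (k \<otimes>\<^bsub>G\<^esub> x [^]\<^bsub>G\<^esub> i) = (\<phi> k + int i * y) mod int n" if "k \<in> K" for k i
      proof -
        let ?l = "k \<otimes>\<^bsub>G\<^esub> (x [^]\<^bsub>G\<^esub> p) [^]\<^bsub>G\<^esub> (i div p)"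
        have "x [^]\<^bsub>G\<^esub> i = (x [^]\<^bsub>G\<^esub> p) [^]\<^bsub>G\<^esub> (i div p) \<otimes>\<^bsub>G\<^esub> x [^]\<^bsub>G\<^esub> (i mod p)"
          using x by (simp add: G.nat_pow_pow G.nat_pow_mult)
        then have "k \<otimes>\<^bsub>G\<^esub> x [^]\<^bsub>G\<^esub> i = ?l \<otimes>\<^bsub>G\<^esub> x [^]\<^bsub>G\<^esub> (i mod p)"
          using that x K.subset by (simp add: G.m_assoc subset_iff)
        then have "\<psi> (k \<otimes>\<^bsub>G\<^esub> x [^]\<^bsub>G\<^esub> i) = (\<phi> ?l + int (i mod p) * y) mod int n"
          using \<psi>1[of ?l "i mod p"] that powK[OF xp] p by simp
        also have "\<phi> ?l = (\<phi> k + (int (i div p) * ((int p * y) mod int n)) mod int n) mod int n"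
          using that powK[OF xp] xp by (simp add: \<phi>m \<phi>p y(3))
        also have "(\<dots> + int (i mod p) * y) mod int n = (\<phi> k + (int p * int (i div p) + int (i mod p)) * y) mod int n"
          by (simp add: mod_simps algebra_simps)
        also have "int p * int (i div p) + int (i mod p) = int i"
          by (metis mult_div_mod_eq of_nat_add of_nat_mult)
        finally show ?thesis .
      qed
      have \<psi>K: "\<psi> k = \<phi> k" if "k \<in> K" for k
        using \<psi>[OF that, of 0] that homs_range[OF \<phi> n(2), of k] K.subset by (simp add: subset_iff)
      have "\<psi> \<in> homs G n"
      proof (rule homsI[OF n(2)])
        show "\<psi> \<in> extensional (carrier G)" by (simp add: \<psi>_def)
        fix g assume g: "g \<in> carrier G"
        then show "0 \<le> \<psi> g \<and> \<psi> g < int n" using n(2) by (simp add: \<psi>_def)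
        fix h assume "h \<in> carrier G"
        with g obtain k i l j where kl: "k \<in> K" "l \<in> K"
          and gh: "g = k \<otimes>\<^bsub>G\<^esub> x [^]\<^bsub>G\<^esub> (i::nat)" "h = l \<otimes>\<^bsub>G\<^esub> x [^]\<^bsub>G\<^esub> (j::nat)"
          using dec by metis
        have "g \<otimes>\<^bsub>G\<^esub> h = (k \<otimes>\<^bsub>G\<^esub> l) \<otimes>\<^bsub>G\<^esub> (x [^]\<^bsub>G\<^esub> i \<otimes>\<^bsub>G\<^esub> x [^]\<^bsub>G\<^esub> j)"
          using kl x K.subset by (simp add: gh G.m_ac subset_iff)
        then have "\<psi> (g \<otimes>\<^bsub>G\<^esub> h) = (\<phi> (k \<otimes>\<^bsub>G\<^esub> l) + int (i + j) * y) mod int n"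
          using \<psi>[of "k \<otimes>\<^bsub>G\<^esub> l" "i + j"] kl x by (simp add: G.nat_pow_mult)
        also have "\<dots> = (\<phi> k + \<phi> l + int (i + j) * y) mod int n"
          using kl by (simp add: \<phi>m mod_add_left_eq)
        also have "\<dots> = ((\<phi> k + int i * y) + (\<phi> l + int j * y)) mod int n"
          by (simp add: algebra_simps)
        also have "\<dots> = (\<psi> g + \<psi> h) mod int n"
          using kl by (simp add: gh \<psi> mod_add_eq)
        finally show "\<psi> (g \<otimes>\<^bsub>G\<^esub> h) = (\<psi> g + \<psi> h) mod int n" .
      qed
      moreover have "R \<psi> = z"
      proof -
        have "restrict \<psi> K = \<phi>"
          using \<phi> \<psi>K by (intro extensionalityI[of _ K]) (auto simp: homs_def)
        moreover have "\<psi> x = y"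
          using \<psi>[OF K.one_closed, of 1] homs_one[OF \<phi> gK.is_group] x y by simp
        ultimately show ?thesis by (simp add: R_def z)
      qed
      ultimately show "z \<in> R ` homs G n" by blast
    qed
  qed
  then have "card (homs G n) = card (Sigma (homs ?K n) Y)" by (rule bij_betw_same_card)
  also have "\<dots> = (\<Sum>\<phi>\<in>homs ?K n. card (Y \<phi>))"
  proof (rule card_SigmaI)
    show "finite (homs ?K n)" using finK n(2) by (intro finite_homs) auto
    show "\<forall>\<phi>\<in>homs ?K n. finite (Y \<phi>)"
      unfolding Y_def by (intro ballI finite_subset[OF Collect_subset]) simp
  qed
  also have "\<dots> = (\<Sum>\<phi>\<in>homs ?K n. p)"
  proof (rule sum.cong[OF refl])
    fix \<phi> assume \<phi>: "\<phi> \<in> homs ?K n"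
    define w where "w = \<phi> (x [^]\<^bsub>G\<^esub> p)"
    have w: "0 \<le> w" "w < int n" using homs_range[OF \<phi> n(2), of "x [^]\<^bsub>G\<^esub> p"] xp by (auto simp: w_def)
    obtain n' where n': "n = p * n'" using n(1) by (meson dvd_mult_left dvdE)
    \<comment> \<open>The order of \<open>K\<close> kills x^p, so \<open>n\<close> divides
      \<open>card K * w\<close>. As \<open>p * card K\<close> divides \<open>n\<close>, cancelling
      \<open>card K\<close> gives that \<open>p\<close> divides \<open>w\<close>.\<close>
    have "(x [^]\<^bsub>G\<^esub> p) [^]\<^bsub>?K\<^esub> card K = \<one>\<^bsub>G\<^esub>"
      using gK.pow_order_eq_1[of "x [^]\<^bsub>G\<^esub> p"] xp by (simp add: order_def)
    then have "(int (card K) * w) mod int n = 0"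
      using homs_nat_pow[OF \<phi> gK.is_group, of "x [^]\<^bsub>G\<^esub> p" "card K"] xp homs_one[OF \<phi> gK.is_group]
      by (simp add: w_def)
    then have "int n dvd int (card K) * w" by (rule mod_0_imp_dvd)
    moreover have "int (p * card K) dvd int n" using n(1) by (simp only: of_nat_dvd_iff)
    ultimately have "int p * int (card K) dvd w * int (card K)" by (metis dvd_trans mult.commute of_nat_mult)
    then have "int p dvd w" using cK by simp
    then obtain z where z: "w = int p * z" by blast
    have "int p * z < int p * int n'" using w z n' by simp
    then have "0 \<le> z" "z < int n'" using w z p by (auto simp: zero_le_mult_iff)
    \<comment> \<open>Dividing the congruence p y = p z modulo p n' by \<open>p\<close> leaves y = z
      modulo n', a single residue class with \<open>p\<close> members below
      \<open>n\<close>.\<close>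
    moreover have "Y \<phi> = {y \<in> {0..<int n' * int p}. y mod int n' = z}"
      using p unfolding Y_def w_def[symmetric] z n' by (auto simp: mult_mod_right[symmetric] mult.commute)
    ultimately show "card (Y \<phi>) = p" using card_residue_class[of z "int n'" "int p"] by simp
  qed
  also have "\<dots> = p * card (homs ?K n)" by simp
  finally show ?thesis .
qed

lemma (in comm_group) comm_group_subgroup:
  assumes "subgroup K G"
  shows "comm_group (G\<lparr>carrier := K\<rparr>)"
proof (rule group.group_comm_groupI[OF subgroup_imp_group[OF assms]])
  show "x \<otimes>\<^bsub>G\<lparr>carrier := K\<rparr>\<^esub> y = y \<otimes>\<^bsub>G\<lparr>carrier := K\<rparr>\<^esub> x"
    if "x \<in> carrier (G\<lparr>carrier := K\<rparr>)" "y \<in> carrier (G\<lparr>carrier := K\<rparr>)" for x y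
    using that subgroup.subset[OF assms] by (auto intro: m_comm)
qed

text \<open>Each step of the induction passes to a subgroup of index \<open>p\<close> and gains a
  factor \<open>p\<close>. The bound \<open>k \<le> e\<close> supplies the divisibility condition at
  every step.\<close>

lemma card_homs_p_group:
  assumes "comm_group G" "finite (carrier G)" "Factorial_Ring.prime p" "order G = p ^ k" "k \<le> e"
  shows "card (homs G (p ^ e)) = p ^ k"
  using assms
proof (induction k arbitrary: G)
  case 0
  then interpret comm_group G by simp
  have "carrier G = {\<one>\<^bsub>G\<^esub>}" using 0 one_closed by (metis card_1_singletonE order_def power_0 singletonD)
  have "homs G (p ^ e) = {\<lambda>x\<in>carrier G. 0}"
  proof (intro equalityI subsetI)
    fix \<phi> assume \<phi>: "\<phi> \<in> homs G (p ^ e)"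
    have "\<phi> = (\<lambda>x\<in>carrier G. 0)"
      using \<phi> homs_one[OF \<phi> is_group] \<open>carrier G = _\<close>
      by (intro extensionalityI[of _ "carrier G"]) (auto simp: homs_def)
    then show "\<phi> \<in> {\<lambda>x\<in>carrier G. 0}" by simp
  qed (use 0 in \<open>auto intro!: homsI simp: prime_gt_0_nat\<close>)
  then show ?case by simp
next
  case (Suc k)
  then interpret comm_group G by simp
  \<comment> \<open>Sylow's theorem is applied with cofactor \<open>p\<close>: it yields a subgroup
    for every power of \<open>p\<close> dividing the order, not only the largest.\<close>
  have "order G = p ^ k * p" using Suc.prems by simp
  then obtain K where K: "subgroup K G" "card K = p ^ k"
    using sylow_thm[OF Suc.prems(3) is_group _ Suc.prems(2)] by blast
  have "card (homs (G\<lparr>carrier := K\<rparr>) (p ^ e)) = p ^ k"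
    using K Suc.prems by (intro Suc.IH) (auto simp: order_def comm_group_subgroup intro: finite_subset[OF subgroup.subset])
  moreover have "p * card K dvd p ^ e"
    using K(2) Suc.prems(5) by (metis le_imp_power_dvd power_Suc)
  ultimately show ?case
    using card_homs_index_prime[OF Suc.prems(1,2) K(1) Suc.prems(3), of "p ^ e"] Suc.prems K(2)
    by (simp add: prime_gt_0_nat)
qed

section \<open>The group of rank four\<close>

lemma comm_group_DirProd:
  assumes "comm_group G" "comm_group H"
  shows "comm_group (G \<times>\<times> H)"
proof -
  interpret G: comm_group G by fact
  interpret H: comm_group H by fact
  show ?thesis
    by (rule group.group_comm_groupI)
      (auto simp: DirProd_group G.is_group H.is_group G.m_comm H.m_comm)
qed

text \<open>From \<open>b \<le> a\<close> follows \<open>b - m \<le> a - m\<close>, so the exponent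
  of the target is large enough for \<open>K\<close> to have exactly \<open>card K\<close>
  homomorphisms into it. The sum is then reindexed by j = b - m.\<close>

lemma card_subgroups_DirProd_large_cyclic:
  assumes "comm_group A" "finite (carrier A)" "Factorial_Ring.prime p" "b \<le> a"
  shows "card (subgroups_of_card (A \<times>\<times> integer_mod_group (p ^ a)) (p ^ b)) =
    (\<Sum>j\<le>b. p ^ j * card (subgroups_of_card A (p ^ j)))"
proof -
  interpret A: comm_group A by fact
  have homs: "card (homs (A\<lparr>carrier := K\<rparr>) (p ^ (a - m))) = p ^ (b - m)"
    if "K \<in> subgroups_of_card A (p ^ (b - m))" for K m
    using that assms by (intro card_homs_p_group A.comm_group_subgroup)
      (auto simp: subgroups_of_card_def order_def intro: finite_subset[OF subgroup.subset])
  have "card (subgroups_of_card (A \<times>\<times> integer_mod_group (p ^ a)) (p ^ b)) =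
      (\<Sum>m\<le>b. p ^ (b - m) * card (subgroups_of_card A (p ^ (b - m))))"
    using assms(4) by (simp add: card_subgroups_DirProd_cyclic[OF A.is_group assms(2,3)] homs min_absorb2 mult.commute)
  also have "\<dots> = (\<Sum>j\<le>b. p ^ j * card (subgroups_of_card A (p ^ j)))"
    by (rule sum.reindex_bij_witness[of _ "\<lambda>j. b - j" "\<lambda>m. b - m"]) auto
  finally show ?thesis .
qed

lemma finite_carrier_integer_mod_group: "0 < n \<Longrightarrow> finite (carrier (integer_mod_group n))"
  by (simp add: carrier_integer_mod_group)

section \<open>From cyclic groups to rank two and rank four\<close>

text \<open>Sylow's theorem gives existence; uniqueness holds because a subgroup of a cyclic group
  is determined by its order.\<close>

lemma card_subgroups_cyclic:
  assumes "Factorial_Ring.prime p"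
  shows "card (subgroups_of_card (integer_mod_group (p ^ a)) (p ^ k)) = (if k \<le> a then 1 else 0)"
proof (cases "k \<le> a")
  case True
  have p: "0 < p ^ a" "1 < p" using prime_gt_1_nat[OF assms] by simp_all
  have "order (integer_mod_group (p ^ a)) = p ^ k * p ^ (a - k)"
    using p True by (simp add: order_def carrier_integer_mod_group nat_power_eq power_add[symmetric])
  then obtain M where M: "M \<in> subgroups_of_card (integer_mod_group (p ^ a)) (p ^ k)"
    using sylow_thm[OF assms group_integer_mod_group _ finite_carrier_integer_mod_group[OF p(1)]]
    unfolding subgroups_of_card_def by blast
  have "N = {c \<in> {0..<int (p ^ a)}. int (p ^ a div p ^ k) dvd c}"
    if "N \<in> subgroups_of_card (integer_mod_group (p ^ a)) (p ^ k)" for N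
    using that subgroup_integer_mod_group(2)[OF p(1), of N] by (simp add: subgroups_of_card_def)
  then have "subgroups_of_card (integer_mod_group (p ^ a)) (p ^ k) = {M}" using M by blast
  then show ?thesis using True by simp
next
  case False
  have p: "0 < p ^ a" "1 < p" using prime_gt_1_nat[OF assms] by simp_all
  have "subgroups_of_card (integer_mod_group (p ^ a)) (p ^ k) = {}"
    using subgroup_integer_mod_group(1)[OF p(1)] False power_dvd_imp_le[OF _ p(2)]
    by (fastforce simp: subgroups_of_card_def)
  then show ?thesis using False by simp
qed

text \<open>The counterpart of \<open>card_homs_p_group\<close> for a small target: \<open>K\<close>
  is cyclic, and since \<open>n\<close> divides its order, the generator may be sent to any element
  of \<int>/n.\<close>

lemma card_homs_cyclic:
  assumes "subgroup K (integer_mod_group N)" "0 < N" "n dvd card K"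
  shows "card (homs ((integer_mod_group N)\<lparr>carrier := K\<rparr>) n) = n"
proof -
  let ?Z = "integer_mod_group N"
  let ?K = "?Z\<lparr>carrier := K\<rparr>"
  interpret gK: group ?K using group.subgroup_imp_group[OF _ assms(1)] by simp
  define s where "s = card K"
  define g where "g = N div s"
  have K: "K = {c \<in> {0..<int N}. int g dvd c}" and "s dvd N"
    using subgroup_integer_mod_group[OF assms(2,1)] by (simp_all add: g_def s_def)
  then have N: "N = g * s" by (simp add: g_def)
  then have pos: "0 < g" "0 < s" using assms(2) by auto
  have n: "n dvd s" "0 < n" using assms(3) pos by (auto simp: s_def intro: Nat.gr0I)
  have elem: "c = int g * (c div int g)" "0 \<le> c div int g" "c div int g < int s" if "c \<in> K" for c
  proof -
    show 1: "c = int g * (c div int g)" using that K by simp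
    show "0 \<le> c div int g" using that K pos by (simp add: pos_imp_zdiv_nonneg_iff)
    have "int g * (c div int g) < int g * int s" using that K N 1 by simp
    then show "c div int g < int s" by (rule mult_left_less_imp_less) simp
  qed
  \<comment> \<open>The reduction matters only for trivial \<open>K\<close>: then
    \<open>g = N\<close>, and the generator is 0.\<close>
  have gen: "int g mod int N \<in> K"
    using K N assms(2) by (simp add: dvd_mod)
  define F where "F = (\<lambda>y. \<lambda>c\<in>K. (c div int g * y) mod int n)"
  have "bij_betw F {0..<int n} (homs ?K n)"
  proof (rule bij_betw_imageI)
    show "inj_on F {0..<int n}"
    proof (cases "s = 1")
      case True
      then have "n = 1" using n by simp
      then show ?thesis by (auto simp: inj_on_def)
    next
      case False
      then have "g < N" using N pos by simp
      then have "F y (int g) = y mod int n" for y using gen pos by (simp add: F_def)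
      then show ?thesis by (intro inj_onI) (metis atLeastLessThan_iff mod_pos_pos_trivial)
    qed
    show "F ` {0..<int n} = homs ?K n"
    proof (intro equalityI subsetI)
      fix \<phi> assume "\<phi> \<in> F ` {0..<int n}"
      then obtain y where y: "\<phi> = F y" by auto
      show "\<phi> \<in> homs ?K n"
      proof (rule homsI[OF n(2)])
        show "\<phi> \<in> extensional (carrier ?K)" by (simp add: y F_def)
        show "0 \<le> \<phi> c \<and> \<phi> c < int n" if "c \<in> carrier ?K" for c using that n by (simp add: y F_def)
        fix c e assume "c \<in> carrier ?K" "e \<in> carrier ?K"
        then have ce: "c \<in> K" "e \<in> K" "(c + e) mod int N \<in> K" using gK.m_closed[of c e] by auto
        \<comment> \<open>Division by \<open>g\<close> identifies \<open>K\<close> with \<int>/s; as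
          \<open>n\<close> divides \<open>s\<close>, the wrap-around modulo \<open>s\<close> is
          invisible modulo \<open>n\<close>.\<close>
        have "(c + e) mod int N = int g * ((c div int g + e div int g) mod int s)"
          using elem(1)[OF ce(1)] elem(1)[OF ce(2)] N
          by (metis distrib_left mult_mod_right of_nat_mult)
        then have "((c + e) mod int N) div int g = (c div int g + e div int g) mod int s"
          using pos by simp
        then have "\<phi> ((c + e) mod int N) = ((c div int g + e div int g) mod int s mod int n * y) mod int n"
          using ce by (simp add: y F_def mod_simps)
        also have "\<dots> = (c div int g * y + e div int g * y) mod int n"
          using n(1) by (simp add: mod_mod_cancel mod_simps algebra_simps)
        finally show "\<phi> (c \<otimes>\<^bsub>?K\<^esub> e) = (\<phi> c + \<phi> e) mod int n"
          using ce by (simp add: y F_def mod_simps)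
      qed
    next
      fix \<phi> assume \<phi>: "\<phi> \<in> homs ?K n"
      define y where "y = \<phi> (int g mod int N)"
      have "\<phi> = F y"
      proof (rule extensionalityI[of _ K])
        fix c assume c: "c \<in> K"
        define t where "t = nat (c div int g)"
        have t: "int t = c div int g" using elem[OF c] by (simp add: t_def)
        have "(int g mod int N) [^]\<^bsub>?K\<^esub> t = (int t * (int g mod int N)) mod int N"
          using monoid.nat_pow_consistent[of ?Z "int g mod int N" t K] by (simp add: group.is_monoid)
        also have "\<dots> = c mod int N" using elem(1)[OF c] t by (simp add: mod_simps mult.commute)
        also have "\<dots> = c" using c K by simp
        finally show "\<phi> c = F y c"
          using homs_nat_pow[OF \<phi> gK.is_group, of "int g mod int N" t] gen c t by (simp add: F_def y_def)
      qed (use \<phi> in \<open>auto simp: homs_def F_def\<close>)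
      moreover have "y \<in> {0..<int n}" using homs_range[OF \<phi> n(2), of "int g mod int N"] gen by (simp add: y_def)
      ultimately show "\<phi> \<in> F ` {0..<int n}" by blast
    qed
  qed
  then show ?thesis by (metis bij_betw_same_card card_atLeastLessThan_int diff_zero nat_int)
qed

text \<open>If \<open>i \<le> a2\<close>, the larger factor can be split off as before. Otherwise
  \<open>K\<close> has order p^(i-m) with \<open>i - m > a2 - m\<close>, so it has p^(a2-m)
  homomorphisms; \<open>K\<close> exists only for \<open>i - m \<le> a1\<close>, which for k = a2 -
  m means \<open>k \<le> a1 + a2 - i\<close>.\<close>

lemma card_subgroups_rank2:
  assumes "Factorial_Ring.prime p" "a1 \<le> a2" "i \<le> a1 + a2"
  shows "card (subgroups_of_card (integer_mod_group (p ^ a1) \<times>\<times> integer_mod_group (p ^ a2)) (p ^ i)) =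
    (\<Sum>k\<le>min i (min a1 (a1 + a2 - i)). p ^ k)"
proof -
  let ?Z = "integer_mod_group (p ^ a1)"
  have p: "0 < p ^ a1" using assms by (simp add: prime_gt_0_nat)
  show ?thesis
  proof (cases "i \<le> a2")
    case True
    have "card (subgroups_of_card (?Z \<times>\<times> integer_mod_group (p ^ a2)) (p ^ i)) =
        (\<Sum>j\<le>i. if j \<le> a1 then p ^ j else 0)"
      using card_subgroups_DirProd_large_cyclic[OF _ finite_carrier_integer_mod_group[OF p] assms(1) True]
      by (simp add: card_subgroups_cyclic[OF assms(1)] if_distrib cong: if_cong)
    also have "\<dots> = (\<Sum>j\<in>{..i} \<inter> {j. j \<le> a1}. p ^ j)" by (simp add: sum.inter_restrict)
    also have "{..i} \<inter> {j. j \<le> a1} = {..min i (min a1 (a1 + a2 - i))}" using True by auto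
    finally show ?thesis .
  next
    case False
    have homs: "card (homs (?Z\<lparr>carrier := K\<rparr>) (p ^ (a2 - m))) = p ^ (a2 - m)"
      if "K \<in> subgroups_of_card ?Z (p ^ (i - m))" for K m
      using that False by (intro card_homs_cyclic[OF _ p]) (auto simp: subgroups_of_card_def le_imp_power_dvd)
    have "card (subgroups_of_card (?Z \<times>\<times> integer_mod_group (p ^ a2)) (p ^ i)) =
        (\<Sum>m\<le>a2. if i - m \<le> a1 then p ^ (a2 - m) else 0)"
      using False card_subgroups_DirProd_cyclic[OF _ finite_carrier_integer_mod_group[OF p] assms(1), of a2 i]
      by (auto simp: homs card_subgroups_cyclic[OF assms(1)] min_absorb1 intro!: sum.cong)
    also have "\<dots> = (\<Sum>m\<in>{..a2} \<inter> {m. i - m \<le> a1}. p ^ (a2 - m))" by (simp add: sum.inter_restrict)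
    also have "\<dots> = (\<Sum>k\<le>min i (min a1 (a1 + a2 - i)). p ^ k)"
      using False assms by (intro sum.reindex_bij_witness[of _ "\<lambda>k. a2 - k" "\<lambda>m. a2 - m"]) auto
    finally show ?thesis .
  qed
qed

text \<open>The bound \<open>b \<le> a3\<close> allows both large factors to be split off, and
  \<open>b \<le> a1 + a2\<close> keeps every index \<open>i\<close> within the range of the rank-two
  count.\<close>

lemma num_subgroups_eq_sum:
  assumes "Factorial_Ring.prime p" "a1 \<le> a2" "a3 \<le> a4" "b \<le> min a3 (a1 + a2)"
  shows "num_subgroups p b (a4, a3, a2, a1) =
    (\<Sum>j\<le>b. p ^ j * (\<Sum>i\<le>j. p ^ i * (\<Sum>k\<le>min i (min a1 (a1 + a2 - i)). p ^ k)))"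
proof -
  let ?Z = "\<lambda>a. integer_mod_group (p ^ a)"
  let ?G2 = "?Z a1 \<times>\<times> ?Z a2"
  let ?G3 = "?G2 \<times>\<times> ?Z a3"
  have p: "0 < p ^ k" for k using assms by (simp add: prime_gt_0_nat)
  have G: "comm_group ?G2" "comm_group ?G3" "finite (carrier ?G2)" "finite (carrier ?G3)"
    using p by (simp_all add: comm_group_DirProd finite_carrier_integer_mod_group)
  \<comment> \<open>The given product is bracketed to the right, whereas splitting off the last
    factor requires bracketing to the left.\<close>
  have "(\<lambda>(w, x, y, z). (((w, x), y), z)) \<in> iso (?Z a1 \<times>\<times> ?Z a2 \<times>\<times> ?Z a3 \<times>\<times> ?Z a4) (?G3 \<times>\<times> ?Z a4)"
    by (force simp: iso_def hom_def inj_on_def bij_betw_def)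
  then have "num_subgroups p b (a4, a3, a2, a1) = card (subgroups_of_card (?G3 \<times>\<times> ?Z a4) (p ^ b))"
    using card_subgroups_iso[of "?Z a1 \<times>\<times> ?Z a2 \<times>\<times> ?Z a3 \<times>\<times> ?Z a4" "?G3 \<times>\<times> ?Z a4"]
    by (simp add: num_subgroups_def abelian_p_group_def subgroups_of_card_def DirProd_group)
  also have "\<dots> = (\<Sum>j\<le>b. p ^ j * card (subgroups_of_card ?G3 (p ^ j)))"
    using assms by (intro card_subgroups_DirProd_large_cyclic G) auto
  also have "\<dots> = (\<Sum>j\<le>b. p ^ j * (\<Sum>i\<le>j. p ^ i * card (subgroups_of_card ?G2 (p ^ i))))"
    using assms by (intro sum.cong refl arg_cong2[of _ _ _ _ "(*)"] card_subgroups_DirProd_large_cyclic G) auto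
  also have "\<dots> = (\<Sum>j\<le>b. p ^ j * (\<Sum>i\<le>j. p ^ i * (\<Sum>k\<le>min i (min a1 (a1 + a2 - i)). p ^ k)))"
    using assms by (intro sum.cong refl arg_cong2[of _ _ _ _ "(*)"] card_subgroups_rank2) auto
  finally show ?thesis .
qed

section \<open>Closed forms\<close>

lemma sum_geometric_real:
  fixes q :: real
  assumes "q \<noteq> 1"
  shows "(q - 1) * (\<Sum>k\<le>n. q ^ k) = q ^ (n + 1) - 1"
  by (induction n) (simp_all add: algebra_simps)

lemma power_double_triple:
  fixes q :: real
  shows "q ^ (2 * n) = q ^ n * q ^ n" "q ^ (3 * n) = q ^ n * q ^ n * q ^ n"
proof -
  have "2 * n = n + n" "3 * n = n + n + n" by simp_all
  then show "q ^ (2 * n) = q ^ n * q ^ n" "q ^ (3 * n) = q ^ n * q ^ n * q ^ n"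
    by (simp_all only: power_add)
qed

text \<open>The sums \<open>r\<close>, \<open>T\<close>, \<open>U\<close> are the counts for two,
  three and four factors. Multiplying \<open>T\<close> by (q-1)(q^2-1) and \<open>U\<close> by
  \<open>D\<close> clears denominators, so each induction step becomes an identity between
  polynomials in powers of \<open>q\<close>.\<close>

context
  fixes q :: real and a1 a2 :: nat and r T U :: "nat \<Rightarrow> real" and D :: real
  assumes q: "1 < q" and a: "a1 \<le> a2"
  defines "r \<equiv> \<lambda>i. \<Sum>k\<le>min i (min a1 (a1 + a2 - i)). q ^ k"
    and "T \<equiv> \<lambda>j. \<Sum>i\<le>j. q ^ i * r i"
    and "U \<equiv> \<lambda>b. \<Sum>j\<le>b. q ^ j * T j"
    and "D \<equiv> (q - 1) * (q ^ 2 - 1) * (q ^ 3 - 1)"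
begin

section \<open>Closed forms for the rank-three sum\<close>

text \<open>With the geometric sum \<open>r\<close> evaluated, only the minimum in the exponent
  distinguishes the three regimes.\<close>

lemma inner_sum_Suc: "(q - 1) * (q\<^sup>2 - 1) * T (Suc j) = (q - 1) * (q\<^sup>2 - 1) * T j
    + (q\<^sup>2 - 1) * q ^ Suc j * (q ^ (min (Suc j) (min a1 (a1 + a2 - Suc j)) + 1) - 1)"
proof -
  have "(q - 1) * r (Suc j) = q ^ (min (Suc j) (min a1 (a1 + a2 - Suc j)) + 1) - 1"
    using q unfolding r_def by (intro sum_geometric_real) simp
  then have "(q\<^sup>2 - 1) * q ^ Suc j * ((q - 1) * r (Suc j)) =
      (q\<^sup>2 - 1) * q ^ Suc j * (q ^ (min (Suc j) (min a1 (a1 + a2 - Suc j)) + 1) - 1)" by simp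
  then show ?thesis by (simp add: T_def algebra_simps)
qed

lemma outer_sum_Suc: "D * U (Suc b) = D * U b + (q ^ 3 - 1) * q ^ Suc b * ((q - 1) * (q\<^sup>2 - 1) * T (Suc b))"
  by (simp add: U_def D_def algebra_simps)

lemma inner_sum_le_a1:
  assumes "j \<le> a1"
  shows "(q - 1) * (q\<^sup>2 - 1) * T j = q ^ (2 * j + 3) - q ^ (j + 2) - q ^ (j + 1) + 1"
  using assms
proof (induction j)
  case 0
  then show ?case by (simp add: T_def r_def eval_nat_numeral algebra_simps)
next
  case (Suc j)
  have m: "min (Suc j) (min a1 (a1 + a2 - Suc j)) = Suc j" using Suc.prems a by simp
  have IH: "(q - 1) * (q\<^sup>2 - 1) * T j = q ^ (2 * j + 3) - q ^ (j + 2) - q ^ (j + 1) + 1"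
    using Suc by simp
  show ?case unfolding inner_sum_Suc m IH
    by (simp add: power_add power_double_triple eval_nat_numeral algebra_simps)
qed

text \<open>Beyond \<open>a1\<close> the minimum stays equal to \<open>a1\<close>, so the increments
  form a geometric progression. The first line is the value at \<open>a1\<close>, the second the sum
  of that progression.\<close>

lemma inner_sum_between:
  assumes "a1 + t \<le> a2"
  shows "(q - 1) * (q\<^sup>2 - 1) * T (a1 + t) = q ^ (2 * a1 + 3) - q ^ (a1 + 2) - q ^ (a1 + 1) + 1
    + (q + 1) * (q ^ (a1 + 1) - 1) * (q ^ (a1 + t + 1) - q ^ (a1 + 1))"
  using assms
proof (induction t)
  case 0
  then show ?case using inner_sum_le_a1[of a1] by simp
next
  case (Suc t)
  have m: "min (Suc (a1 + t)) (min a1 (a1 + a2 - Suc (a1 + t))) = a1" using Suc.prems by simp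
  have "a1 + t \<le> a2" using Suc.prems by simp
  note IH = Suc.IH[OF this]
  show ?case unfolding add_Suc_right inner_sum_Suc m IH
    by (simp add: power_add power_double_triple eval_nat_numeral algebra_simps)
qed

text \<open>At \<open>a2 + t\<close> the minimum is \<open>a1 - t\<close>, so the growth of q^(a2+t)
  cancels its decay. Each step contributes the same power q^(a1+a2+1), which produces the factor
  \<open>t\<close> and ultimately the coefficient b + 1 - a2.\<close>

lemma inner_sum_ge_a2:
  assumes "t \<le> a1"
  shows "(q - 1) * (q\<^sup>2 - 1) * T (a2 + t) = q ^ (2 * a1 + 3) - q ^ (a1 + 2) - q ^ (a1 + 1) + 1
    + (q + 1) * (q ^ (a1 + 1) - 1) * (q ^ (a2 + 1) - q ^ (a1 + 1))
    + real t * (q\<^sup>2 - 1) * q ^ (a1 + a2 + 1) - (q + 1) * (q ^ (a2 + t + 1) - q ^ (a2 + 1))"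
  using assms
proof (induction t)
  case 0
  then show ?case using inner_sum_between[of "a2 - a1"] a by simp
next
  case (Suc t)
  have m: "min (Suc (a2 + t)) (min a1 (a1 + a2 - Suc (a2 + t))) = a1 - Suc t" using Suc.prems a by simp
  have "t \<le> a1" using Suc.prems by simp
  note IH = Suc.IH[OF this]
  have "Suc (a2 + t) + (a1 - Suc t + 1) = a1 + a2 + 1" using Suc.prems by simp
  then have "q ^ Suc (a2 + t) * q ^ (a1 - Suc t + 1) = q ^ (a1 + a2 + 1)" by (metis power_add)
  then have *: "(q\<^sup>2 - 1) * q ^ Suc (a2 + t) * (q ^ (a1 - Suc t + 1) - 1) =
      (q\<^sup>2 - 1) * (q ^ (a1 + a2 + 1) - q ^ Suc (a2 + t))"
    by (simp only: right_diff_distrib mult.assoc mult_1_right)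
  show ?case unfolding add_Suc_right inner_sum_Suc m IH *
    by (simp add: power_add eval_nat_numeral algebra_simps)
qed

section \<open>Closed forms for the rank-four sum\<close>

lemma outer_sum_le_a1:
  assumes "b \<le> a1"
  shows "D * U b = q ^ (3 * b + 6) - q ^ (2 * b + 5) - q ^ (2 * b + 4) - q ^ (2 * b + 3)
               + q ^ (b + 3) + q ^ (b + 2) + q ^ (b + 1) - 1"
  using assms
proof (induction b)
  case 0
  then show ?case by (simp add: U_def D_def T_def r_def eval_nat_numeral algebra_simps)
next
  case (Suc b)
  have "b \<le> a1" using Suc.prems by simp
  note IH = Suc.IH[OF this]
  show ?case unfolding outer_sum_Suc IH inner_sum_le_a1[OF Suc.prems]
    by (simp add: power_add power_double_triple eval_nat_numeral algebra_simps)
qed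

lemma outer_sum_between:
  assumes "a1 + t \<le> a2"
  shows "D * U (a1 + t) = q ^ (2 * (a1 + t) + a1 + 6) + q ^ (2 * (a1 + t) + a1 + 5) + q ^ (2 * (a1 + t) + a1 + 4)
               - q ^ (2 * a1 + (a1 + t) + 5) - q ^ (2 * a1 + (a1 + t) + 4) - q ^ (2 * a1 + (a1 + t) + 3)
               + q ^ (3 * a1 + 3)
               - q ^ (2 * (a1 + t) + 5) - q ^ (2 * (a1 + t) + 4) - q ^ (2 * (a1 + t) + 3)
               + q ^ ((a1 + t) + 3) + q ^ ((a1 + t) + 2) + q ^ ((a1 + t) + 1) - 1"
  using assms
proof (induction t)
  case 0
  then show ?case using outer_sum_le_a1[of a1] by (simp add: power_add power_double_triple eval_nat_numeral)
next
  case (Suc t)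
  have "a1 + t \<le> a2" using Suc.prems by simp
  note IH = Suc.IH[OF this]
  show ?case unfolding add_Suc_right outer_sum_Suc IH inner_sum_between[OF Suc.prems, unfolded add_Suc_right]
    by (simp add: power_add power_double_triple eval_nat_numeral algebra_simps)
qed

lemma outer_sum_ge_a2:
  assumes "t \<le> a1"
  shows "D * U (a2 + t) = (real t + 1) * q ^ (a2 + a1 + (a2 + t) + 6)
               + (real t + 1) * q ^ (a2 + a1 + (a2 + t) + 5)
               - (real t + 1) * q ^ (a2 + a1 + (a2 + t) + 3)
               - (real t + 1) * q ^ (a1 + a2 + (a2 + t) + 2)
               + q ^ (2 * a2 + a1 + 4) + q ^ (a1 + 2 * a2 + 3) + q ^ (a1 + 2 * a2 + 2)
               - q ^ (2 * a1 + (a2 + t) + 5) - q ^ (2 * a1 + (a2 + t) + 4) - q ^ (2 * a1 + (a2 + t) + 3)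
               + q ^ ((a2 + t) + 3) + q ^ ((a2 + t) + 2) + q ^ ((a2 + t) + 1)
               + q ^ (3 * a1 + 3)
               - q ^ (2 * (a2 + t) + 5) - q ^ (2 * (a2 + t) + 4) - q ^ (2 * (a2 + t) + 3) - 1"
  using assms
proof (induction t)
  case 0
  \<comment> \<open>Adjacent regimes share their boundary value, so the preceding formula at b = a2
    starts this induction.\<close>
  then show ?case using outer_sum_between[of "a2 - a1"] a
    by (simp add: power_add power_double_triple eval_nat_numeral)
next
  case (Suc t)
  have "t \<le> a1" using Suc.prems by simp
  note IH = Suc.IH[OF this]
  show ?case unfolding add_Suc_right outer_sum_Suc IH inner_sum_ge_a2[OF Suc.prems, unfolded add_Suc_right]
    by (simp add: power_add power_double_triple eval_nat_numeral algebra_simps)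
qed

end

theorem mainTheorem2:
  fixes p a1 a2 a3 a4 :: nat and q D :: real
    and lam :: "nat \<times> nat \<times> nat \<times> nat"
  assumes "Factorial_Ring.prime p"
    and "1 \<le> a1" "a1 \<le> a2" "a2 \<le> a3" "a3 \<le> a4"
  defines "lam \<equiv> (a4, a3, a2, a1)"
    and "q \<equiv> real p"
    and "D \<equiv> (q - 1) * (q ^ 2 - 1) * (q ^ 3 - 1)"
  shows "(\<forall>b::nat. 0 \<le> b \<and> b \<le> a1 \<longrightarrow>
            real (num_subgroups p b lam) =
              (q ^ (3 * b + 6) - q ^ (2 * b + 5) - q ^ (2 * b + 4) - q ^ (2 * b + 3)
               + q ^ (b + 3) + q ^ (b + 2) + q ^ (b + 1) - 1) / D)
       \<and> (\<forall>b::nat. a1 \<le> b \<and> b \<le> a2 \<longrightarrow>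
            real (num_subgroups p b lam) =
              (q ^ (2 * b + a1 + 6) + q ^ (2 * b + a1 + 5) + q ^ (2 * b + a1 + 4)
               - q ^ (2 * a1 + b + 5) - q ^ (2 * a1 + b + 4) - q ^ (2 * a1 + b + 3)
               + q ^ (3 * a1 + 3)
               - q ^ (2 * b + 5) - q ^ (2 * b + 4) - q ^ (2 * b + 3)
               + q ^ (b + 3) + q ^ (b + 2) + q ^ (b + 1) - 1) / D)
       \<and> (\<forall>b::nat. a2 \<le> b \<and> b \<le> min a3 (a1 + a2) \<longrightarrow>
            real (num_subgroups p b lam) =
              ((real b + 1 - real a2) * q ^ (a2 + a1 + b + 6)
               + (real b + 1 - real a2) * q ^ (a2 + a1 + b + 5)
               + (real a2 - real b - 1) * q ^ (a2 + a1 + b + 3)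
               + (real a2 - real b - 1) * q ^ (a1 + a2 + b + 2)
               + q ^ (2 * a2 + a1 + 4) + q ^ (a1 + 2 * a2 + 3) + q ^ (a1 + 2 * a2 + 2)
               - q ^ (2 * a1 + b + 5) - q ^ (2 * a1 + b + 4) - q ^ (2 * a1 + b + 3)
               + q ^ (b + 3) + q ^ (b + 2) + q ^ (b + 1)
               + q ^ (3 * a1 + 3)
               - q ^ (2 * b + 5) - q ^ (2 * b + 4) - q ^ (2 * b + 3) - 1) / D)"
proof -
  have q: "1 < q" using prime_gt_1_nat[OF assms(1)] by (simp add: q_def)
  then have "1 < q ^ 2" "1 < q ^ 3" by (simp_all only: one_less_power zero_less_numeral)
  with q have "0 < D" unfolding D_def by (intro mult_pos_pos) linarith+
  then have D: "D \<noteq> 0" by simp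
  let ?U = "\<lambda>b. \<Sum>j\<le>b. q ^ j * (\<Sum>i\<le>j. q ^ i * (\<Sum>k\<le>min i (min a1 (a1 + a2 - i)). q ^ k))"
  \<comment> \<open>All three cases satisfy this bound, since
    \<open>a2 \<le> min a3 (a1 + a2)\<close>; each is thereby reduced to its closed form for D times
    the sum.\<close>
  have N: "real (num_subgroups p b lam) = A / D" if "b \<le> min a3 (a1 + a2)" "D * ?U b = A" for b A
  proof -
    have "real (num_subgroups p b lam) = ?U b"
      using num_subgroups_eq_sum[OF assms(1,3,5) that(1)] by (simp add: lam_def q_def)
    then show ?thesis using that(2) D by (simp add: field_simps)
  qed
  show ?thesis
  proof (intro conjI allI impI)
    fix b assume "0 \<le> b \<and> b \<le> a1"
    then show "real (num_subgroups p b lam) =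
              (q ^ (3 * b + 6) - q ^ (2 * b + 5) - q ^ (2 * b + 4) - q ^ (2 * b + 3)
               + q ^ (b + 3) + q ^ (b + 2) + q ^ (b + 1) - 1) / D"
      using assms(3,4) outer_sum_le_a1[OF q assms(3), of b] by (intro N) (simp_all add: D_def)
  next
    fix b assume b: "a1 \<le> b \<and> b \<le> a2"
    then have "a1 + (b - a1) = b" by simp
    then show "real (num_subgroups p b lam) =
              (q ^ (2 * b + a1 + 6) + q ^ (2 * b + a1 + 5) + q ^ (2 * b + a1 + 4)
               - q ^ (2 * a1 + b + 5) - q ^ (2 * a1 + b + 4) - q ^ (2 * a1 + b + 3)
               + q ^ (3 * a1 + 3)
               - q ^ (2 * b + 5) - q ^ (2 * b + 4) - q ^ (2 * b + 3)
               + q ^ (b + 3) + q ^ (b + 2) + q ^ (b + 1) - 1) / D"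
      using b assms(4) outer_sum_between[OF q assms(3), of "b - a1"] by (intro N) (simp_all only: D_def, simp)
  next
    fix b assume b: "a2 \<le> b \<and> b \<le> min a3 (a1 + a2)"
    \<comment> \<open>The closed form is stated at offset t = b - a2; as \<open>a2 \<le> b\<close>,
      this difference is not truncated and passes to the reals, turning t + 1 into b + 1 -
      a2.\<close>
    then have t: "a2 + (b - a2) = b" "b - a2 \<le> a1" "real (b - a2) = real b - real a2" by auto
    show "real (num_subgroups p b lam) =
              ((real b + 1 - real a2) * q ^ (a2 + a1 + b + 6)
               + (real b + 1 - real a2) * q ^ (a2 + a1 + b + 5)
               + (real a2 - real b - 1) * q ^ (a2 + a1 + b + 3)
               + (real a2 - real b - 1) * q ^ (a1 + a2 + b + 2)
               + q ^ (2 * a2 + a1 + 4) + q ^ (a1 + 2 * a2 + 3) + q ^ (a1 + 2 * a2 + 2)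
               - q ^ (2 * a1 + b + 5) - q ^ (2 * a1 + b + 4) - q ^ (2 * a1 + b + 3)
               + q ^ (b + 3) + q ^ (b + 2) + q ^ (b + 1)
               + q ^ (3 * a1 + 3)
               - q ^ (2 * b + 5) - q ^ (2 * b + 4) - q ^ (2 * b + 3) - 1) / D"
    proof (rule N)
      show "b \<le> min a3 (a1 + a2)" using b by simp
    qed (unfold D_def outer_sum_ge_a2[OF q assms(3) t(2), unfolded t], simp add: algebra_simps)
  qed
qed

end
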